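(* Let $n\ge2$ and let $V$ be an irreducible $J\oplus D$-module with finite dimensional weight spaces with respect to $\mathfrak h_0$. Assume that there exist non-zero central operators $z_1,\dots,z_{n-1}$ on $V$ of degrees $(k_1,0,\dots,0),\dots,(0,\dots,0,k_{n-1},0)\in\mathbb Z^n$ respectively, where each $k_i$ is a positive integer. Let $W$ be a maximal $J\oplus D_{n-1}$-submodule of $V$ such that $V_1=V/W$ is an irreducible $J\oplus D_{n-1}$-module with finite dimensional weight spaces with respect to $\mathfrak h_{n-1}$. Then each $z$ in $Z$ acts as a scalar on $V_1$. Further, each $z$ in $Z$ which acts as a non-zero operator on $V$ acts as a non-zero scalar on $V_1$.
   Context: $\mathfrak g$ is a finite dimensional simple Lie algebra over $\mathbb C$ with non-degenerate invariant symmetric bilinear form $(\cdot,\cdot)$ and Cartan subalgebra $\mathfrak h$. $\mathfrak g_{\rm aff}=\mathfrak g\otimes\mathbb C[t_n^{\pm1}]\oplus\mathbb C K_n$ with $[x\otimes t_n^a,y\otimes t_n^b]=[x,y]\otimes t_n^{a+b}+a\,\delta_{a+b,0}(x,y)K_n$ and $K_n$ central. $A_{n-1}=\mathbb C[t_1^{\pm1},\dots,t_{n-1}^{\pm1}]$, $t^{\overline m}=t_1^{m_1}\cdots t_{n-1}^{m_{n-1}}$ for $\overline m\in\mathbb Z^{n-1}$, and $J=\mathfrak g_{\rm aff}\otimes A_{n-1}$ with bracket $[X\otimes f,Y\otimes g]=[X,Y]\otimes fg$. $D$ is the span of commuting elements $d_1,\dots,d_n$, and $J\oplus D$ is the semidirect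 product in which $d_i$ acts on $J$ as the degree derivation $t_i\frac{\partial}{\partial t_i}$ ($K_n$ having degree $0$). $D_k$ is the span of $d_{k+1},\dots,d_n$, so $D_0=D$ and $D_{n-1}=\mathbb C d_n$, and $\mathfrak h_k=\mathfrak h\oplus\mathbb C K_n\oplus D_k$. Having finite dimensional weight spaces with respect to $\mathfrak h_k$ means that the module is the direct sum of its simultaneous eigenspaces (weight spaces) for $\mathfrak h_k$ and that these are finite dimensional. $Z$ is the vector space spanned by the symbols $t^{\underline m}K_i$ ($1\le i\le n$, $\underline m=(m_1,\dots,m_n)\in\mathbb Z^n$) subject to the relations $\sum_i m_it^{\underline m}K_i=0$; it is the center of the universal central extension $\mathfrak g\otimes\mathbb C[t_1^{\pm1},\dots,t_n^{\pm1}]\oplus Z$ of $\mathfrak g\otimes\mathbb C[t_1^{\pm1},\dots,t_n^{\pm1}]$. It acts on $J\oplus D$-modules (and on $J\oplus D_{n-1}$-modules) through the linear map $Z\to J$ sending $t^{\underline m}K_i$ to $0$ if $1\le i\le n-1$ or if $i=n$ and $m_n\ne0$, and sending $t^{\underline m}K_n$ to $K_n\otimes t_1^{m_1}\cdots t_{n-1}^{m_{n-1}}$ if $m_n=0$; the image is the center $K_n\otimes A_{n-1}$ of $J$. Central operators: on an irreducible $J\oplus D$-module $V$ with finite dimensional weight spaces, every element $K_n\otimes t^{\overline m}$ that acts as a non-zero operator on $V$ acts invertibly. A central operator on $V$ is a scalar multiple of a finite product of operators by which such elements act and of inverses of such operators; it commutes with the action of $J$, and it has degree $\underline m\in\mathbb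 Z^n$ if $d_iz-zd_i=m_iz$ for $1\le i\le n$.
   Formalization: The second claim is proved only for z in Z acting on V by an operator that has a degree in Z^n (all homogeneous z); for arbitrary z it fails: on V=L⊗A_{n-1} with K_n acting as c≠0, z=t_1K_n−K_n is non-zero on V but zero on V_1 = V at t=(1,…,1). *)

theory Defs
  imports Complex_Main "HOL-Library.Poly_Mapping" "HOL-Library.Product_Plus"
begin

section \<open>Vector spaces and Lie algebras\<close>

definition fin_dim :: "(complex \<Rightarrow> 'v \<Rightarrow> 'v) \<Rightarrow> 'v::ab_group_add set \<Rightarrow> bool" where
  "fin_dim s U \<longleftrightarrow> (\<exists>B. finite B \<and> module.span s B = U)"

locale lie_algebra = vector_space s
  for s :: "complex \<Rightarrow> 'g::ab_group_add \<Rightarrow> 'g" +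
  fixes br :: "'g \<Rightarrow> 'g \<Rightarrow> 'g"
  assumes linear_left: "Vector_Spaces.linear s s (\<lambda>x. br x y)"
    and linear_right: "Vector_Spaces.linear s s (br x)"
    and alternating: "br x x = 0"
    and jacobi: "br x (br y z) + br y (br z x) + br z (br x y) = 0"

definition lie_ideal :: "(complex \<Rightarrow> 'g \<Rightarrow> 'g) \<Rightarrow> ('g \<Rightarrow> 'g \<Rightarrow> 'g) \<Rightarrow> 'g::ab_group_add set \<Rightarrow> bool" where
  "lie_ideal s br I \<longleftrightarrow> module.subspace s I \<and> (\<forall>x. \<forall>y\<in>I. br x y \<in> I)"

definition fd_simple_lie_algebra ::
  "(complex \<Rightarrow> 'g \<Rightarrow> 'g) \<Rightarrow> ('g \<Rightarrow> 'g \<Rightarrow> 'g::ab_group_add) \<Rightarrow> bool" where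
  "fd_simple_lie_algebra s br \<longleftrightarrow>
     lie_algebra s br \<and> fin_dim s (UNIV :: 'g set) \<and>
     (\<exists>x y. br x y \<noteq> 0) \<and> (\<forall>I. lie_ideal s br I \<longrightarrow> I = {0} \<or> I = UNIV)"

definition nondeg_invariant_form ::
  "(complex \<Rightarrow> 'g \<Rightarrow> 'g) \<Rightarrow> ('g \<Rightarrow> 'g \<Rightarrow> 'g::ab_group_add) \<Rightarrow> ('g \<Rightarrow> 'g \<Rightarrow> complex) \<Rightarrow> bool" where
  "nondeg_invariant_form s br form \<longleftrightarrow>
     (\<forall>y. Vector_Spaces.linear s (*) (\<lambda>x. form x y)) \<and>
     (\<forall>x y. form x y = form y x) \<and>
     (\<forall>x y z. form (br x y) z = form x (br y z)) \<and>
     (\<forall>x. (\<forall>y. form x y = 0) \<longrightarrow> x = 0)"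

fun lower_central ::
  "(complex \<Rightarrow> 'g \<Rightarrow> 'g) \<Rightarrow> ('g \<Rightarrow> 'g \<Rightarrow> 'g::ab_group_add) \<Rightarrow> 'g set \<Rightarrow> nat \<Rightarrow> 'g set" where
  "lower_central s br H 0 = H"
| "lower_central s br H (Suc k) =
     module.span s {br x y | x y. x \<in> H \<and> y \<in> lower_central s br H k}"

definition cartan_subalgebra ::
  "(complex \<Rightarrow> 'g \<Rightarrow> 'g) \<Rightarrow> ('g \<Rightarrow> 'g \<Rightarrow> 'g::ab_group_add) \<Rightarrow> 'g set \<Rightarrow> bool" where
  "cartan_subalgebra s br H \<longleftrightarrow>
     module.subspace s H \<and> (\<forall>x\<in>H. \<forall>y\<in>H. br x y \<in> H) \<and>
     (\<exists>k. lower_central s br H k = {0}) \<and>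
     {x. \<forall>y\<in>H. br x y \<in> H} = H"


section \<open>The Lie algebras $J$ and $J \oplus D_k$\<close>

text \<open>
  Vectors with a basis indexed by \<^typ>\<open>'i\<close> are finitely supported functions.
  An element of $\mathfrak g_{\rm aff}$ is a pair $(f, a)$ standing for
  $\sum_b f(b) \otimes t_n^b + a K_n$, and $X : J$ stands for
  $\sum_m X(m) \otimes t^m$. Exponents are finitely supported functions on the
  positive integers, so that the number $n$ of variables is an ordinary parameter:
  the types below allow arbitrarily many variables, and the carriers
  \<open>JD n k\<close>, \<open>cartan_k n H k\<close> cut out the objects with exactly $n$ of them.
\<close>

type_synonym expo = "nat \<Rightarrow>\<^sub>0 int"
type_synonym 'g aff = "(int \<Rightarrow>\<^sub>0 'g) \<times> complex"
type_synonym 'g jalg = "expo \<Rightarrow>\<^sub>0 'g aff"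
type_synonym 'g jd = "'g jalg \<times> (nat \<Rightarrow>\<^sub>0 complex)"

definition lattice :: "nat \<Rightarrow> expo set" where
  "lattice n = {m. Poly_Mapping.keys m \<subseteq> {1..n}}"

definition scale_fs :: "(complex \<Rightarrow> 'b \<Rightarrow> 'b) \<Rightarrow> complex \<Rightarrow> ('i \<Rightarrow>\<^sub>0 'b::zero) \<Rightarrow> ('i \<Rightarrow>\<^sub>0 'b)" where
  "scale_fs s c f = Poly_Mapping.map (s c) f"

definition scale_aff :: "(complex \<Rightarrow> 'g \<Rightarrow> 'g) \<Rightarrow> complex \<Rightarrow> 'g::ab_group_add aff \<Rightarrow> 'g aff" where
  "scale_aff s c X = (scale_fs s c (fst X), c * snd X)"

definition scale_jd :: "(complex \<Rightarrow> 'g \<Rightarrow> 'g) \<Rightarrow> complex \<Rightarrow> 'g::ab_group_add jd \<Rightarrow> 'g jd" where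
  "scale_jd s c X = (scale_fs (scale_aff s) c (fst X), scale_fs (*) c (snd X))"

definition br_aff ::
  "('g \<Rightarrow> 'g \<Rightarrow> 'g) \<Rightarrow> ('g \<Rightarrow> 'g \<Rightarrow> complex) \<Rightarrow> 'g::ab_group_add aff \<Rightarrow> 'g aff \<Rightarrow> 'g aff" where
  "br_aff br form X Y =
     (\<Sum>a\<in>Poly_Mapping.keys (fst X). \<Sum>b\<in>Poly_Mapping.keys (fst Y).
        let x = Poly_Mapping.lookup (fst X) a; y = Poly_Mapping.lookup (fst Y) b
        in (Poly_Mapping.single (a + b) (br x y),
            if a + b = 0 then of_int a * form x y else 0))"

definition br_J ::
  "('g \<Rightarrow> 'g \<Rightarrow> 'g) \<Rightarrow> ('g \<Rightarrow> 'g \<Rightarrow> complex) \<Rightarrow> 'g::ab_group_add jalg \<Rightarrow> 'g jalg \<Rightarrow> 'g jalg" where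
  "br_J br form X Y =
     (\<Sum>m\<in>Poly_Mapping.keys X. \<Sum>p\<in>Poly_Mapping.keys Y.
        Poly_Mapping.single (m + p)
          (br_aff br form (Poly_Mapping.lookup X m) (Poly_Mapping.lookup Y p)))"

text \<open>The action of $\sum_i c_i d_i$ on $J$: on $(x \otimes t_n^b) \otimes t^m$ it is
  multiplication by $\sum_{i<n} c_i m_i + c_n b$, and on $K_n \otimes t^m$ by
  $\sum_{i<n} c_i m_i$.\<close>

definition der_aff :: "(complex \<Rightarrow> 'g \<Rightarrow> 'g) \<Rightarrow> 'g::ab_group_add aff \<Rightarrow> 'g aff" where
  "der_aff s X =
     (\<Sum>b\<in>Poly_Mapping.keys (fst X).
        Poly_Mapping.single b (s (of_int b) (Poly_Mapping.lookup (fst X) b)), 0)"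

definition der_J ::
  "nat \<Rightarrow> (complex \<Rightarrow> 'g \<Rightarrow> 'g) \<Rightarrow> (nat \<Rightarrow>\<^sub>0 complex) \<Rightarrow> 'g::ab_group_add jalg \<Rightarrow> 'g jalg" where
  "der_J n s c X =
     (\<Sum>m\<in>Poly_Mapping.keys X. Poly_Mapping.single m
        (scale_aff s (\<Sum>i\<in>{1..<n}. Poly_Mapping.lookup c i * of_int (Poly_Mapping.lookup m i))
             (Poly_Mapping.lookup X m)
         + scale_aff s (Poly_Mapping.lookup c n) (der_aff s (Poly_Mapping.lookup X m))))"

definition br_jd ::
  "nat \<Rightarrow> (complex \<Rightarrow> 'g \<Rightarrow> 'g) \<Rightarrow> ('g \<Rightarrow> 'g \<Rightarrow> 'g) \<Rightarrow> ('g \<Rightarrow> 'g \<Rightarrow> complex)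
     \<Rightarrow> 'g::ab_group_add jd \<Rightarrow> 'g jd \<Rightarrow> 'g jd" where
  "br_jd n s br form X Y =
     (br_J br form (fst X) (fst Y) + der_J n s (snd X) (fst Y) - der_J n s (snd Y) (fst X), 0)"

definition JD :: "nat \<Rightarrow> nat \<Rightarrow> 'g::ab_group_add jd set" where
  "JD n k = {X. Poly_Mapping.keys (fst X) \<subseteq> lattice (n - 1) \<and>
                Poly_Mapping.keys (snd X) \<subseteq> {k+1..n}}"

definition cartan_k :: "nat \<Rightarrow> 'g set \<Rightarrow> nat \<Rightarrow> 'g::ab_group_add jd set" where
  "cartan_k n H k =
     {(Poly_Mapping.single 0 (Poly_Mapping.single 0 h, a), c) | h a c.
        h \<in> H \<and> Poly_Mapping.keys c \<subseteq> {k+1..n}}"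

definition d_elt :: "nat \<Rightarrow> 'g::ab_group_add jd" where
  "d_elt i = (0, Poly_Mapping.single i 1)"

text \<open>The element $K_n \otimes t^m$.\<close>
definition K_elt :: "expo \<Rightarrow> 'g::ab_group_add jd" where
  "K_elt m = (Poly_Mapping.single m (0, 1), 0)"


section \<open>The space $Z$ and its map to $J$\<close>

text \<open>\<^term>\<open>Poly_Mapping.single (m, i) 1\<close> is the symbol $t^m K_i$, and $Z$ is the quotient of
  the free vector space on these symbols by the span of the relations.\<close>

type_synonym zfree = "(expo \<times> nat) \<Rightarrow>\<^sub>0 complex"

definition Z_free :: "nat \<Rightarrow> zfree set" where
  "Z_free n = {f. Poly_Mapping.keys f \<subseteq> lattice n \<times> {1..n}}"

definition Z_rel :: "nat \<Rightarrow> expo \<Rightarrow> zfree" where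
  "Z_rel n m = (\<Sum>i=1..n. Poly_Mapping.single (m, i) (of_int (Poly_Mapping.lookup m i)))"

definition Z_equiv :: "nat \<Rightarrow> (zfree \<times> zfree) set" where
  "Z_equiv n = {(f, g). f \<in> Z_free n \<and> g \<in> Z_free n \<and>
                        f - g \<in> module.span (scale_fs (*)) (Z_rel n ` lattice n)}"

definition Z_space :: "nat \<Rightarrow> zfree set set" where
  "Z_space n = Z_free n // Z_equiv n"

definition Z_free_to_jd :: "nat \<Rightarrow> zfree \<Rightarrow> 'g::ab_group_add jd" where
  "Z_free_to_jd n f =
     (\<Sum>(m, i)\<in>Poly_Mapping.keys f.
        if i = n \<and> Poly_Mapping.lookup m n = 0
        then Poly_Mapping.single m (0, Poly_Mapping.lookup f (m, i)) else 0,
      0)"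

text \<open>\<^term>\<open>Z_free_to_jd n\<close> is constant on each class, see \<open>Z_to_jd_class\<close> below.\<close>
definition Z_to_jd :: "nat \<Rightarrow> zfree set \<Rightarrow> 'g::ab_group_add jd" where
  "Z_to_jd n z = the_elem (Z_free_to_jd n ` z)"


section \<open>Modules\<close>

text \<open>A Lie algebra is given here by a carrier \<open>S\<close> inside a type with scaling \<open>sL\<close> and bracket
  \<open>brL\<close>; values of an action \<open>\<rho>\<close> outside \<open>S\<close> are irrelevant.\<close>

definition lie_module ::
  "'l::ab_group_add set \<Rightarrow> (complex \<Rightarrow> 'l \<Rightarrow> 'l) \<Rightarrow> ('l \<Rightarrow> 'l \<Rightarrow> 'l)
     \<Rightarrow> (complex \<Rightarrow> 'v \<Rightarrow> 'v) \<Rightarrow> ('l \<Rightarrow> 'v \<Rightarrow> 'v::ab_group_add) \<Rightarrow> bool" where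
  "lie_module S sL brL sV \<rho> \<longleftrightarrow>
     vector_space sV \<and>
     (\<forall>x\<in>S. Vector_Spaces.linear sV sV (\<rho> x)) \<and>
     (\<forall>x\<in>S. \<forall>y\<in>S. \<forall>v. \<rho> (x + y) v = \<rho> x v + \<rho> y v) \<and>
     (\<forall>c. \<forall>x\<in>S. \<forall>v. \<rho> (sL c x) v = sV c (\<rho> x v)) \<and>
     (\<forall>x\<in>S. \<forall>y\<in>S. \<forall>v. \<rho> (brL x y) v = \<rho> x (\<rho> y v) - \<rho> y (\<rho> x v))"

definition submodule ::
  "'l set \<Rightarrow> (complex \<Rightarrow> 'v \<Rightarrow> 'v) \<Rightarrow> ('l \<Rightarrow> 'v \<Rightarrow> 'v::ab_group_add) \<Rightarrow> 'v set \<Rightarrow> bool" where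
  "submodule S sV \<rho> W \<longleftrightarrow> module.subspace sV W \<and> (\<forall>x\<in>S. \<forall>w\<in>W. \<rho> x w \<in> W)"

definition maximal_submodule ::
  "'l set \<Rightarrow> (complex \<Rightarrow> 'v \<Rightarrow> 'v) \<Rightarrow> ('l \<Rightarrow> 'v \<Rightarrow> 'v::ab_group_add) \<Rightarrow> 'v set \<Rightarrow> bool" where
  "maximal_submodule S sV \<rho> W \<longleftrightarrow>
     submodule S sV \<rho> W \<and> W \<noteq> UNIV \<and>
     (\<forall>U. submodule S sV \<rho> U \<and> W \<subseteq> U \<longrightarrow> U = W \<or> U = UNIV)"

definition irreducible_module ::
  "'l::ab_group_add set \<Rightarrow> (complex \<Rightarrow> 'l \<Rightarrow> 'l) \<Rightarrow> ('l \<Rightarrow> 'l \<Rightarrow> 'l)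
     \<Rightarrow> (complex \<Rightarrow> 'v \<Rightarrow> 'v) \<Rightarrow> ('l \<Rightarrow> 'v \<Rightarrow> 'v::ab_group_add) \<Rightarrow> bool" where
  "irreducible_module S sL brL sV \<rho> \<longleftrightarrow>
     lie_module S sL brL sV \<rho> \<and> (\<exists>v::'v. v \<noteq> 0) \<and>
     (\<forall>W. submodule S sV \<rho> W \<longrightarrow> W = {0} \<or> W = UNIV)"

text \<open>\<open>\<pi>\<close> exhibits the module with action \<open>\<rho>Q\<close> as the quotient by \<open>W\<close>: a surjective module
  homomorphism with kernel \<open>W\<close>, which determines the quotient up to unique isomorphism.\<close>
definition quotient_module ::
  "'l set \<Rightarrow> (complex \<Rightarrow> 'v \<Rightarrow> 'v) \<Rightarrow> ('l \<Rightarrow> 'v \<Rightarrow> 'v::ab_group_add) \<Rightarrow> 'v set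
     \<Rightarrow> (complex \<Rightarrow> 'w \<Rightarrow> 'w) \<Rightarrow> ('l \<Rightarrow> 'w \<Rightarrow> 'w::ab_group_add) \<Rightarrow> ('v \<Rightarrow> 'w) \<Rightarrow> bool" where
  "quotient_module S sV \<rho> W sQ \<rho>Q \<pi> \<longleftrightarrow>
     Vector_Spaces.linear sV sQ \<pi> \<and> surj \<pi> \<and> {v. \<pi> v = 0} = W \<and>
     (\<forall>x\<in>S. \<forall>v. \<pi> (\<rho> x v) = \<rho>Q x (\<pi> v))"

definition weight_space ::
  "'l set \<Rightarrow> (complex \<Rightarrow> 'v \<Rightarrow> 'v) \<Rightarrow> ('l \<Rightarrow> 'v \<Rightarrow> 'v::ab_group_add) \<Rightarrow> ('l \<Rightarrow> complex) \<Rightarrow> 'v set" where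
  "weight_space h sV \<rho> \<mu> = {v. \<forall>x\<in>h. \<rho> x v = sV (\<mu> x) v}"

text \<open>The sum of the simultaneous eigenspaces is automatically direct, so that it suffices
  to ask that they span. Functions \<open>\<mu>\<close> that agree on \<open>h\<close> give the same space, and the
  weight space of a \<open>\<mu>\<close> that is not linear on \<open>h\<close> is zero.\<close>
definition fd_weight_spaces ::
  "'l set \<Rightarrow> (complex \<Rightarrow> 'v \<Rightarrow> 'v) \<Rightarrow> ('l \<Rightarrow> 'v \<Rightarrow> 'v::ab_group_add) \<Rightarrow> bool" where
  "fd_weight_spaces h sV \<rho> \<longleftrightarrow>
     module.span sV (\<Union>\<mu>. weight_space h sV \<rho> \<mu>) = UNIV \<and>
     (\<forall>\<mu>. fin_dim sV (weight_space h sV \<rho> \<mu>))"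


section \<open>Central operators\<close>

inductive central_product :: "nat \<Rightarrow> ('g::ab_group_add jd \<Rightarrow> 'v \<Rightarrow> 'v) \<Rightarrow> ('v::ab_group_add \<Rightarrow> 'v) \<Rightarrow> bool"
  for n :: nat and \<rho> :: "'g::ab_group_add jd \<Rightarrow> 'v \<Rightarrow> 'v::ab_group_add" where
  one: "central_product n \<rho> id"
| elt: "central_product n \<rho> (\<rho> (K_elt m) \<circ> p)"
    if "central_product n \<rho> p" "m \<in> lattice (n - 1)" "\<rho> (K_elt m) \<noteq> (\<lambda>v. 0)"
| inverse_elt: "central_product n \<rho> (q \<circ> p)"
    if "central_product n \<rho> p" "m \<in> lattice (n - 1)" "\<rho> (K_elt m) \<noteq> (\<lambda>v. 0)"
       "q \<circ> \<rho> (K_elt m) = id" "\<rho> (K_elt m) \<circ> q = id"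

definition central_operator ::
  "nat \<Rightarrow> (complex \<Rightarrow> 'v \<Rightarrow> 'v) \<Rightarrow> ('g::ab_group_add jd \<Rightarrow> 'v \<Rightarrow> 'v) \<Rightarrow> ('v::ab_group_add \<Rightarrow> 'v) \<Rightarrow> bool" where
  "central_operator n sV \<rho> z \<longleftrightarrow> (\<exists>c p. central_product n \<rho> p \<and> z = (\<lambda>v. sV c (p v)))"

text \<open>The notion of degree applies to any operator. The operator by which a homogeneous element of $Z$
  acts always has one (\<open>has_degree_K_elt\<close> below). A sum of elements of $Z$ of
  different degrees can be non-zero on a module and zero on a quotient: with $L$ an
  irreducible highest weight module on which $K_n$ is non-zero, $K_n \otimes (t_1 - 1)$ is non-zero on
  $L \otimes A_{n-1}$, and zero on the quotient obtained by putting all $t_i = 1$.\<close>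
definition has_degree ::
  "nat \<Rightarrow> (complex \<Rightarrow> 'v \<Rightarrow> 'v) \<Rightarrow> ('g::ab_group_add jd \<Rightarrow> 'v \<Rightarrow> 'v) \<Rightarrow> ('v::ab_group_add \<Rightarrow> 'v) \<Rightarrow> expo \<Rightarrow> bool" where
  "has_degree n sV \<rho> z m \<longleftrightarrow>
     (\<forall>i\<in>{1..n}. \<forall>v. \<rho> (d_elt i) (z v) - z (\<rho> (d_elt i) v)
                      = sV (of_int (Poly_Mapping.lookup m i)) (z v))"


section \<open>Basic facts\<close>

lemma br_aff_monomial:
  assumes "lie_algebra s br" "nondeg_invariant_form s br form"
  shows "br_aff br form (Poly_Mapping.single a x, u) (Poly_Mapping.single b y, w)
         = (Poly_Mapping.single (a + b) (br x y), if a + b = 0 then of_int a * form x y else 0)"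
proof -
  interpret lie_algebra s br by fact
  have l: "br 0 y = 0" "br x 0 = 0" for x y
    using module_hom.zero[OF Vector_Spaces.linear.axioms(3)[OF linear_left]]
      module_hom.zero[OF Vector_Spaces.linear.axioms(3)[OF linear_right]] by auto
  have f0: "form 0 y = 0" for y
    using assms(2) module_hom.zero[OF Vector_Spaces.linear.axioms(3)]
    unfolding nondeg_invariant_form_def by blast
  have f: "form 0 y = 0" "form x 0 = 0" for x y
    using f0 assms(2) unfolding nondeg_invariant_form_def by metis+
  show ?thesis
    by (cases "x = 0"; cases "y = 0") (auto simp: br_aff_def l f zero_prod_def)
qed

lemma br_J_monomial:
  "br_J br form (Poly_Mapping.single m X) (Poly_Mapping.single p Y)
   = Poly_Mapping.single (m + p) (br_aff br form X Y)"
  by (cases "X = 0"; cases "Y = 0") (auto simp: br_J_def br_aff_def)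

lemma br_jd_d_elt_K_elt:
  assumes "lie_algebra s br" "i \<in> {1..n}" "m \<in> lattice (n - 1)"
  shows "br_jd n s br form (d_elt i) (K_elt m)
         = scale_jd s (of_int (Poly_Mapping.lookup m i)) (K_elt m)"
proof -
  interpret lie_algebra s br by fact
  have sum: "(\<Sum>j\<in>{1..<n}. Poly_Mapping.lookup (Poly_Mapping.single i (1::complex)) j
        * of_int (Poly_Mapping.lookup m j)) = of_int (Poly_Mapping.lookup m i)"
  proof (cases "i = n")
    case True
    have "n \<notin> Poly_Mapping.keys m" using assms(2,3) by (auto simp: lattice_def)
    then show ?thesis using True by (auto simp: lookup_single when_def in_keys_iff)
  next
    case False
    with assms(2) have "i \<in> {1..<n}" by auto
    then show ?thesis
      by (simp add: lookup_single when_def if_distrib[of "\<lambda>x. x * _"] cong: if_cong)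
  qed
  have z: "scale_fs s c 0 = (0 :: int \<Rightarrow>\<^sub>0 'a)" "scale_fs (*) c (0 :: nat \<Rightarrow>\<^sub>0 complex) = 0"
    for c :: complex
    by (auto intro!: poly_mapping_eqI simp: scale_fs_def Poly_Mapping.map.rep_eq when_def)
  have one: "scale_fs (scale_aff s) c (Poly_Mapping.single m (0, 1))
      = Poly_Mapping.single m (0 :: int \<Rightarrow>\<^sub>0 'a, c)" for c
    by (rule poly_mapping_eqI)
       (auto simp: scale_fs_def Poly_Mapping.map.rep_eq when_def lookup_single scale_aff_def
             zero_prod_def z[unfolded scale_fs_def])
  have "der_J n s (Poly_Mapping.single i 1) (Poly_Mapping.single m (0, 1))
      = Poly_Mapping.single m (0 :: int \<Rightarrow>\<^sub>0 'a, of_int (Poly_Mapping.lookup m i))"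
    unfolding der_J_def by (simp add: zero_prod_def scale_aff_def der_aff_def z sum[unfolded One_nat_def])
  moreover have "der_J n s 0 (0 :: 'a jalg) = 0" "br_J br form 0 (X :: 'a jalg) = 0" for X
    by (simp_all add: der_J_def br_J_def)
  ultimately show ?thesis
    by (simp add: br_jd_def d_elt_def K_elt_def scale_jd_def one z)
qed

lemma has_degree_K_elt:
  assumes "lie_algebra s br" "m \<in> lattice (n - 1)"
    and "lie_module (JD n 0) (scale_jd s) (br_jd n s br form) sV \<rho>"
  shows "has_degree n sV \<rho> (\<rho> (K_elt m)) m"
proof -
  have K: "K_elt m \<in> JD n 0" using assms(2) by (auto simp: K_elt_def JD_def)
  have d: "d_elt i \<in> JD n 0" if "i \<in> {1..n}" for i
    using that by (auto simp: d_elt_def JD_def)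
  show ?thesis
    using assms(3) K d br_jd_d_elt_K_elt[OF assms(1) _ assms(2), of _ form]
    unfolding has_degree_def lie_module_def by metis
qed

lemma Z_free_to_jd_symbol:
  "Z_free_to_jd n (Poly_Mapping.single (m, i) 1)
   = (if i = n \<and> Poly_Mapping.lookup m n = 0 then K_elt m else 0)"
  by (auto simp: Z_free_to_jd_def K_elt_def zero_prod_def)

lemma lookup_Z_free_to_jd:
  "Poly_Mapping.lookup (fst (Z_free_to_jd n f)) m
   = (0, if Poly_Mapping.lookup m n = 0 then Poly_Mapping.lookup f (m, n) else 0)"
proof -
  have "Poly_Mapping.lookup (fst (Z_free_to_jd n f :: 'a jd)) m =
    (\<Sum>q\<in>Poly_Mapping.keys f. if q = (m, n)
       then (0, if Poly_Mapping.lookup m n = 0 then Poly_Mapping.lookup f (m, n) else 0) else 0)"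
    unfolding Z_free_to_jd_def fst_conv lookup_sum
    by (rule sum.cong) (auto simp: lookup_single when_def zero_prod_def split: if_splits)
  then show ?thesis by (auto simp: in_keys_iff zero_prod_def)
qed

lemma Z_free_to_jd_eqI:
  assumes "\<And>m. Poly_Mapping.lookup m n = 0 \<Longrightarrow> Poly_Mapping.lookup f (m, n) = Poly_Mapping.lookup g (m, n)"
  shows "Z_free_to_jd n f = Z_free_to_jd n g"
proof (rule prod_eqI)
  show "fst (Z_free_to_jd n f) = fst (Z_free_to_jd n g)"
    by (rule poly_mapping_eqI) (simp add: lookup_Z_free_to_jd assms)
qed (simp add: Z_free_to_jd_def)

lemma lookup_scale_fs:
  "Poly_Mapping.lookup (scale_fs (*) c f) k = c * Poly_Mapping.lookup f k"
  for c :: complex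
  by (simp add: scale_fs_def Poly_Mapping.map.rep_eq when_def)

lemma vector_space_scale_fs: "vector_space (scale_fs (*) :: complex \<Rightarrow> ('i \<Rightarrow>\<^sub>0 complex) \<Rightarrow> _)"
  by unfold_locales
     (auto intro!: poly_mapping_eqI simp: lookup_scale_fs lookup_add algebra_simps)

lemma lookup_Z_rel:
  "Poly_Mapping.lookup (Z_rel n m) (p, i)
   = (if p = m \<and> i \<in> {1..n} then of_int (Poly_Mapping.lookup m i) else 0)"
  by (auto simp: Z_rel_def lookup_sum lookup_single when_def if_distrib cong: if_cong)

lemma Z_to_jd_class:
  assumes "z \<in> Z_space n" "f \<in> z"
  shows "Z_to_jd n z = Z_free_to_jd n f"
proof -
  interpret vs: vector_space "scale_fs (*) :: complex \<Rightarrow> zfree \<Rightarrow> zfree"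
    by (rule vector_space_scale_fs)
  have 0: "\<forall>m. Poly_Mapping.lookup m n = 0 \<longrightarrow> Poly_Mapping.lookup r (m, n) = 0"
    if "r \<in> vs.span (Z_rel n ` lattice n)" for r
    using that
    by (induction rule: vs.span_induct_alt) (auto simp: lookup_add lookup_scale_fs lookup_Z_rel split: if_splits)
  obtain h where h: "z = Z_equiv n `` {h}"
    using assms(1) by (auto simp: Z_space_def elim: quotientE)
  have eq: "(Z_free_to_jd n g :: 'a jd) = Z_free_to_jd n h" if "g \<in> z" for g
    using that 0[of "h - g"]
    by (intro Z_free_to_jd_eqI) (auto simp: h Z_equiv_def lookup_minus)
  have "Z_free_to_jd n ` z = {Z_free_to_jd n h :: 'a jd}"
    using eq assms(2) by (auto simp: image_iff)
  then show ?thesis by (simp add: Z_to_jd_def eq[OF assms(2)])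
qed

end

(* A central element of J \<oplus> D_(n-1) has an eigenvector in any non-zero weight space of V1, so by
   Schur's lemma it acts on V1 as a scalar. If it acts on V by a non-zero homogeneous operator, the
   range of this operator is a non-zero J \<oplus> D-submodule of V, hence all of V. So the operator is
   also surjective on the quotient V1, and the scalar cannot be 0. *)

theory Submission
  imports Defs "HOL-Computational_Algebra.Fundamental_Theorem_Algebra"
begin

section \<open>Eigenvectors in finite dimensional invariant subspaces\<close>

text \<open>This is p(T)v, written as an explicit sum because the scaling \<open>s\<close> is a
  parameter and \<open>T\<close> a plain function.\<close>

definition poly_op ::
  "(complex \<Rightarrow> 'v \<Rightarrow> 'v) \<Rightarrow> ('v \<Rightarrow> 'v) \<Rightarrow> complex poly \<Rightarrow> 'v \<Rightarrow> 'v::ab_group_add" where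
  "poly_op s T p v = (\<Sum>i\<le>degree p. s (coeff p i) ((T ^^ i) v))"

text \<open>Permits one summation range for polynomials of different degrees, so that linearity in
  the polynomial can be checked termwise.\<close>

lemma poly_op_altdef:
  assumes "vector_space s" "degree p \<le> N"
  shows "poly_op s T p v = (\<Sum>i\<le>N. s (coeff p i) ((T ^^ i) v))"
proof -
  interpret vector_space s by fact
  show ?thesis unfolding poly_op_def
    by (rule sum.mono_neutral_left) (use assms(2) in \<open>auto simp: coeff_eq_0\<close>)
qed

lemma poly_op_diff:
  assumes "vector_space s"
  shows "poly_op s T (p - q) v = poly_op s T p v - poly_op s T q v"
proof -
  interpret vector_space s by fact
  define N where "N = max (degree p) (degree q)"
  have "degree p \<le> N" "degree q \<le> N" "degree (p - q) \<le> N"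
    using degree_diff_le_max[of p q] by (auto simp: N_def)
  then show ?thesis
    by (simp add: poly_op_altdef[OF assms, of _ N] scale_left_diff_distrib sum_subtractf)
qed

lemma poly_op_smult:
  assumes "vector_space s"
  shows "poly_op s T (smult c p) v = s c (poly_op s T p v)"
proof -
  interpret vector_space s by fact
  show ?thesis
    by (simp add: poly_op_altdef[OF assms, of _ "degree p"] scale_sum_right degree_smult_le)
qed

text \<open>\<open>pCons 0 p\<close> is X p, so multiplication by X turns into application of
  \<open>T\<close>. With the rules for differences and scalar multiples this evaluates (X - c) q at
  \<open>T\<close>.\<close>

lemma poly_op_pCons_0:
  assumes "Vector_Spaces.linear s s T"
  shows "poly_op s T (pCons 0 p) v = T (poly_op s T p v)"
proof -
  interpret T: Vector_Spaces.linear s s T by fact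
  have "poly_op s T (pCons 0 p) v
      = (\<Sum>i\<le>Suc (degree p). s (coeff (pCons 0 p) i) ((T ^^ i) v))"
    by (rule poly_op_altdef[OF T.vs1.vector_space_axioms]) (rule degree_pCons_le)
  also have "\<dots> = (\<Sum>i\<le>degree p. s (coeff p i) (T ((T ^^ i) v)))"
    by (subst sum.atMost_Suc_shift) simp
  also have "\<dots> = T (poly_op s T p v)"
    by (simp add: poly_op_def T.sum T.scale)
  finally show ?thesis .
qed

lemma funpow_invariant:
  assumes "\<And>u. u \<in> U \<Longrightarrow> T u \<in> U" "v \<in> U"
  shows "(T ^^ i) v \<in> U"
  using assms by (induction i) auto

text \<open>Induction on the degree: a root c of p gives p = (X - c) q. Either q(T)v is non-zero,
  and then it is an eigenvector for c, or q is an annihilating polynomial of smaller degree.\<close>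

lemma eigenvector_of_annihilating_poly:
  assumes T: "Vector_Spaces.linear s s T"
    and U: "module.subspace s U" "\<And>u. u \<in> U \<Longrightarrow> T u \<in> U"
    and v: "v \<in> U" "v \<noteq> 0"
    and p: "p \<noteq> 0" "poly_op s T p v = 0"
  shows "\<exists>u\<in>U. \<exists>c. u \<noteq> 0 \<and> T u = s c u"
  using p
proof (induction "degree p" arbitrary: p rule: less_induct)
  case less
  interpret T: Vector_Spaces.linear s s T by fact
  note vs = T.vs1.vector_space_axioms
  \<comment> \<open>A non-zero constant a would give a v = 0 although v is non-zero.\<close>
  have "degree p \<noteq> 0"
  proof
    assume "degree p = 0"
    then obtain a where "p = [:a:]" by (rule degree_eq_zeroE)
    then show False using less.prems v by (simp add: poly_op_def)
  qed
  then obtain c where "poly p c = 0"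
    using fundamental_theorem_of_algebra[of p] by (auto simp: constant_degree)
  then obtain q where q: "p = [:-c, 1:] * q"
    by (auto simp: poly_eq_0_iff_dvd)
  then have "q \<noteq> 0" using less.prems by auto
  \<comment> \<open>In the form X q - c q, the equation p(T)v = 0 reads T(q(T)v) = c q(T)v.\<close>
  have "p = pCons 0 q - smult c q" by (simp add: q)
  then have eq: "T (poly_op s T q v) = s c (poly_op s T q v)"
    using less.prems(2) by (simp add: poly_op_diff[OF vs] poly_op_smult[OF vs] poly_op_pCons_0[OF T])
  have "poly_op s T q v \<in> U" unfolding poly_op_def
    using U v by (intro T.vs1.subspace_sum T.vs1.subspace_scale funpow_invariant) auto
  moreover have ?case if "poly_op s T q v = 0"
  proof (rule less.hyps)
    show "degree q < degree p"
      unfolding q using \<open>q \<noteq> 0\<close> by (subst degree_mult_eq) auto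
  qed (use that \<open>q \<noteq> 0\<close> in auto)
  ultimately show ?case using eq by blast
qed

text \<open>With N the size of a finite spanning set, the N + 1 vectors v, Tv, ..., T^N v are
  linearly dependent, and the coefficients of a relation are those of p.\<close>

lemma annihilating_poly_exists:
  assumes "vector_space s" "fin_dim s U"
    and U: "\<And>u. u \<in> U \<Longrightarrow> T u \<in> U" and v: "v \<in> U"
  shows "\<exists>p. p \<noteq> 0 \<and> poly_op s T p v = 0"
proof -
  interpret vector_space s by fact
  obtain B where B: "finite B" "span B = U"
    using assms(2) by (auto simp: fin_dim_def)
  let ?N = "card B" and ?f = "\<lambda>i. (T ^^ i) v"
  show ?thesis
  \<comment> \<open>Dependence is a property of sets and does not see repeated vectors. A
    coincidence T^i v = T^j v is therefore treated separately, with p = X^i - X^j.\<close>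
  proof (cases "inj_on ?f {..?N}")
    case True
    have "\<not> independent (?f ` {..?N})"
      using independent_span_bound[OF B(1), of "?f ` {..?N}"] funpow_invariant[of U T v] U v B(2)
      by (auto simp: card_image[OF True])
    then obtain a where a: "\<exists>w\<in>?f ` {..?N}. a w \<noteq> 0" "(\<Sum>w\<in>?f ` {..?N}. s (a w) w) = 0"
      by (auto simp: dependent_finite)
    define p where "p = (\<Sum>i\<le>?N. monom (a (?f i)) i)"
    have coeff_p: "coeff p i = (if i \<le> ?N then a (?f i) else 0)" for i
      by (auto simp: p_def coeff_sum)
    have "degree p \<le> ?N" by (rule degree_le) (simp add: coeff_p)
    then have "poly_op s T p v = (\<Sum>i\<le>?N. s (a (?f i)) (?f i))"
      by (simp add: poly_op_altdef[OF assms(1)] coeff_p)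
    also have "\<dots> = 0" using a(2) by (simp add: sum.reindex[OF True])
    finally have "poly_op s T p v = 0" .
    moreover have "p \<noteq> 0"
    proof
      assume "p = 0"
      then have "a (?f i) = 0" if "i \<le> ?N" for i using coeff_p[of i] that by simp
      then show False using a(1) by auto
    qed
    ultimately show ?thesis by blast
  next
    case False
    then obtain i j where ij: "i \<noteq> j" "?f i = ?f j" by (auto simp: inj_on_def)
    have m: "poly_op s T (monom 1 i) v = ?f i" for i
      by (simp add: poly_op_def degree_monom_eq if_distrib[of "\<lambda>c. s c _"] cong: if_cong)
    have "poly_op s T (monom 1 i - monom 1 j) v = 0"
      by (simp add: poly_op_diff[OF assms(1)] m ij(2))
    moreover have "coeff (monom (1::complex) i - monom 1 j) i \<noteq> 0" using ij(1) by simp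
    then have "monom (1::complex) i - monom 1 j \<noteq> 0" by force
    ultimately show ?thesis by blast
  qed
qed

lemma eigenvector_exists:
  assumes T: "Vector_Spaces.linear s s T"
    and "fin_dim s U" "\<And>u. u \<in> U \<Longrightarrow> T u \<in> U" "v \<in> U" "v \<noteq> 0"
  shows "\<exists>u\<in>U. \<exists>c. u \<noteq> 0 \<and> T u = s c u"
proof -
  interpret T: Vector_Spaces.linear s s T by fact
  have "\<exists>p. p \<noteq> 0 \<and> poly_op s T p v = 0"
    by (rule annihilating_poly_exists[OF T.vs1.vector_space_axioms assms(2)]) (fact assms)+
  then obtain p where p: "p \<noteq> 0" "poly_op s T p v = 0" by blast
  have U: "T.vs1.subspace U" using assms(2) by (auto simp: fin_dim_def)
  show ?thesis
    by (rule eigenvector_of_annihilating_poly[OF T U _ _ _ p]) (fact assms)+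
qed


section \<open>Endomorphisms of irreducible modules\<close>

text \<open>If all weight spaces were zero, so would be their span, the whole module. The vector
  found here starts the search for an eigenvector in Schur's lemma.\<close>

lemma exists_nonzero_weight_vector:
  fixes sV :: "complex \<Rightarrow> 'v::ab_group_add \<Rightarrow> 'v" and v :: 'v
  assumes "vector_space sV" "fd_weight_spaces h sV \<rho>" "v \<noteq> 0"
  shows "\<exists>\<mu>. \<exists>u\<in>weight_space h sV \<rho> \<mu>. u \<noteq> 0"
proof (rule ccontr)
  interpret vector_space sV by fact
  assume "\<not> ?thesis"
  then have "(\<Union>\<mu>. weight_space h sV \<rho> \<mu>) \<subseteq> {0}" by blast
  then have "span (\<Union>\<mu>. weight_space h sV \<rho> \<mu>) \<subseteq> {0}"
    using span_minimal subspace_single_0 by blast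
  moreover have "v \<in> span (\<Union>\<mu>. weight_space h sV \<rho> \<mu>)"
    using assms(2) by (simp add: fd_weight_spaces_def)
  ultimately show False using assms(3) by auto
qed

text \<open>Since \<open>T\<close> commutes with \<open>h\<close>, it preserves a non-zero weight
  space, which is finite dimensional and so contains an eigenvector. The eigenspace of
  \<open>T\<close> in the whole module is then a non-zero submodule, hence everything.\<close>

lemma schur_scalar:
  assumes irr: "irreducible_module S sL brL sV \<rho>"
    and fd: "fd_weight_spaces h sV \<rho>" and "h \<subseteq> S"
    and T: "Vector_Spaces.linear sV sV T"
    and comm: "\<And>x v. x \<in> S \<Longrightarrow> T (\<rho> x v) = \<rho> x (T v)"
  shows "\<exists>c. \<forall>v. T v = sV c v"
proof -
  interpret T: Vector_Spaces.linear sV sV T by fact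
  have lin: "Vector_Spaces.linear sV sV (\<rho> x)" if "x \<in> S" for x
    using irr that by (auto simp: irreducible_module_def lie_module_def)
  have scale: "\<rho> x (sV c v) = sV c (\<rho> x v)" if "x \<in> S" for x c v
    using module_hom.scale[OF Vector_Spaces.linear.axioms(3)[OF lin[OF that]]] .
  obtain v :: 'b where "v \<noteq> 0" using irr by (auto simp: irreducible_module_def)
  then obtain \<mu> u where u: "u \<in> weight_space h sV \<rho> \<mu>" "u \<noteq> 0"
    using exists_nonzero_weight_vector[OF T.vs1.vector_space_axioms fd] by blast
  have "T w \<in> weight_space h sV \<rho> \<mu>" if "w \<in> weight_space h sV \<rho> \<mu>" for w
    unfolding weight_space_def
  proof safe
    fix x assume "x \<in> h"
    with \<open>h \<subseteq> S\<close> that show "\<rho> x (T w) = sV (\<mu> x) (T w)"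
      by (auto simp: weight_space_def T.scale simp flip: comm)
  qed
  moreover have "fin_dim sV (weight_space h sV \<rho> \<mu>)" using fd by (simp add: fd_weight_spaces_def)
  ultimately obtain w c where w: "w \<noteq> 0" "T w = sV c w"
    using eigenvector_exists[OF T _ _ u] by blast
  have "submodule S sV \<rho> {v. T v = sV c v}"
    unfolding submodule_def T.vs1.subspace_def
    by (auto simp: T.add T.scale T.vs1.scale_right_distrib T.vs1.scale_left_commute comm scale)
  then have "{v. T v = sV c v} = UNIV"
    using irr w by (auto simp: irreducible_module_def)
  then show ?thesis by blast
qed

text \<open>Only invariance of the range is assumed, not that \<open>T\<close> commutes with the
  action: a central element of non-zero degree need not commute with the d_i.\<close>

lemma surj_of_range_submodule:
  assumes irr: "irreducible_module S sL brL sV \<rho>"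
    and T: "Vector_Spaces.linear sV sV T" "T \<noteq> (\<lambda>v. 0)"
    and inv: "\<And>x v. x \<in> S \<Longrightarrow> \<rho> x (T v) \<in> range T"
  shows "surj T"
proof -
  interpret T: Vector_Spaces.linear sV sV T by fact
  have "submodule S sV \<rho> (range T)"
    using inv T.subspace_image[OF T.vs1.subspace_UNIV] by (auto simp: submodule_def)
  moreover have "range T \<noteq> {0}"
  proof -
    obtain v where "T v \<noteq> 0" using T(2) by auto
    then show ?thesis by auto
  qed
  ultimately show ?thesis using irr by (auto simp: irreducible_module_def)
qed


section \<open>The center of $J$\<close>

text \<open>This is K_n tensor A_{n-1} inside J + D: every coefficient in g_aff has zero loop part,
  and there is no D-part.\<close>

definition center_J :: "nat \<Rightarrow> 'g::ab_group_add jd set" where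
  "center_J n = {Y. Poly_Mapping.keys (fst Y) \<subseteq> lattice (n - 1) \<and>
                    (\<forall>m. fst (Poly_Mapping.lookup (fst Y) m) = 0) \<and> snd Y = 0}"

lemma JD_antimono: "k \<le> l \<Longrightarrow> JD n l \<subseteq> JD n k"
  unfolding JD_def using atLeastatMost_subset_iff[of "l + 1" n "k + 1" n] by fastforce

lemma center_J_subset_JD: "center_J n \<subseteq> JD n k"
  by (auto simp: center_J_def JD_def)

lemma cartan_k_subset_JD: "cartan_k n H k \<subseteq> JD n k"
  by (auto simp: cartan_k_def JD_def lattice_def split: if_splits)

lemma Z_to_jd_in_center_J:
  assumes "z \<in> Z_space n"
  shows "Z_to_jd n z \<in> center_J n"
proof -
  interpret vs: vector_space "scale_fs (*) :: complex \<Rightarrow> zfree \<Rightarrow> zfree"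
    by (rule vector_space_scale_fs)
  obtain f where f: "f \<in> Z_free n" "z = Z_equiv n `` {f}"
    using assms by (auto simp: Z_space_def elim: quotientE)
  then have "f \<in> z" by (simp add: Z_equiv_def vs.span_zero)
  then have eq: "Z_to_jd n z = (Z_free_to_jd n f :: 'a jd)"
    by (rule Z_to_jd_class[OF assms])
  \<comment> \<open>An exponent in t_1, ..., t_n with m_n = 0 involves only t_1, ..., t_{n-1}. These
    are the symbols t^m K_n that survive in J.\<close>
  have "m \<in> lattice (n - 1)"
    if "Poly_Mapping.lookup m n = 0" "Poly_Mapping.lookup f (m, n) \<noteq> 0" for m
  proof -
    have "m \<in> lattice n" using f(1) that(2) by (auto simp: Z_free_def in_keys_iff)
    moreover have "n \<notin> Poly_Mapping.keys m" using that(1) by (simp add: in_keys_iff)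
    moreover have "{1..n} - {n} = {1..n - 1}" by auto
    ultimately show ?thesis by (auto simp: lattice_def)
  qed
  then have "Poly_Mapping.keys (fst (Z_free_to_jd n f :: 'a jd)) \<subseteq> lattice (n - 1)"
    by (auto simp: in_keys_iff lookup_Z_free_to_jd zero_prod_def split: if_splits)
  then show ?thesis
    by (simp add: eq center_J_def lookup_Z_free_to_jd) (simp add: Z_free_to_jd_def)
qed

lemma scale_fs_zero_right: "scale_fs s c 0 = 0"
  by (rule poly_mapping_eqI) (simp add: scale_fs_def Poly_Mapping.map.rep_eq)

lemma scale_fs_zero_left:
  assumes "\<And>x. s 0 x = 0"
  shows "scale_fs s 0 f = 0"
  by (rule poly_mapping_eqI) (simp add: scale_fs_def Poly_Mapping.map.rep_eq when_def assms)

text \<open>The bracket of g_aff sees only loop parts, so J commutes with its center. Of D only d_n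
  is present, and it kills K_n tensor t^m because K_n has degree 0; d_i with i < n would scale this
  element by m_i.\<close>

lemma br_jd_center_J:
  assumes "lie_algebra s br" and Y: "Y \<in> center_J n" and "X \<in> JD n (n - 1)"
  shows "br_jd n s br form X Y = 0"
proof -
  interpret lie_algebra s br by fact
  have s0: "scale_aff s 0 A = 0" for A :: "'a aff"
    by (simp add: scale_aff_def zero_prod_def scale_fs_zero_left)
  have d: "der_aff s A = 0" if "fst A = 0" for A :: "'a aff"
    using that by (simp add: der_aff_def zero_prod_def)
  \<comment> \<open>Hence the sum over i < n in \<open>der_J\<close> vanishes and only the term of
    d_n remains.\<close>
  have c: "Poly_Mapping.lookup (snd X) i = 0" if "i < n" for i
  proof -
    have "Poly_Mapping.keys (snd X) \<subseteq> {n - 1 + 1..n}" using assms(3) by (simp add: JD_def)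
    then have "i \<notin> Poly_Mapping.keys (snd X)" using that by auto
    then show ?thesis by (simp add: in_keys_iff)
  qed
  have fst0: "fst (Poly_Mapping.lookup (fst Y) m) = 0" for m
    using Y by (simp add: center_J_def)
  have "br_J br form (fst X) (fst Y) = 0"
    by (simp add: br_J_def br_aff_def fst0)
  moreover have "der_J n s (snd X) (fst Y) = 0"
    by (simp add: der_J_def c s0 d fst0) (simp add: scale_aff_def scale_fs_zero_right flip: zero_prod_def)
  moreover have "der_J n s (snd Y) (fst X) = 0"
    using Y by (simp add: der_J_def s0 center_J_def)
  ultimately show ?thesis by (simp add: br_jd_def zero_prod_def)
qed

lemma lie_module_zero:
  assumes "lie_module S sL brL sV \<rho>" "0 \<in> S"
  shows "\<rho> 0 v = 0"
proof -
  have "\<rho> (0 + 0) v = \<rho> 0 v + \<rho> 0 v" using assms unfolding lie_module_def by blast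
  then show ?thesis by simp
qed

text \<open>\<open>k\<close> belongs to the algebra that acts, while \<open>X\<close> always lies in
  J + D_{n-1}. The lemma serves V1 with k = n - 1 and V with k = 0.\<close>

lemma center_J_commutes:
  assumes "lie_algebra s br" "lie_module (JD n k) (scale_jd s) (br_jd n s br form) sV \<rho>"
    and "Y \<in> center_J n" "X \<in> JD n (n - 1)" "k \<le> n - 1"
  shows "\<rho> Y (\<rho> X v) = \<rho> X (\<rho> Y v)"
proof -
  have "X \<in> JD n k" "Y \<in> JD n k" "0 \<in> JD n k"
    using assms(3-5) JD_antimono[of k "n - 1" n] center_J_subset_JD[of n k] by (auto simp: JD_def)
  then have "\<rho> X (\<rho> Y v) - \<rho> Y (\<rho> X v) = \<rho> 0 v" "\<rho> 0 v = 0"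
    using assms(2) lie_module_zero[OF assms(2)] br_jd_center_J[OF assms(1,3,4), of form]
    unfolding lie_module_def by metis+
  then show ?thesis by simp
qed


section \<open>Reduction from $J \oplus D$ to $J$ and the $d_i$\<close>

lemma scale_jd_d_elt: "scale_jd s c (d_elt i) = (0, Poly_Mapping.single i c)"
  by (simp add: scale_jd_def d_elt_def scale_fs_zero_right)
     (rule poly_mapping_eqI, simp add: lookup_scale_fs lookup_single when_def)

text \<open>A degree is a condition on the single d_i, whereas a submodule must be stable under all
  of J + D. The bridge is to write an element as its J-part plus a finite combination of the
  d_i.\<close>

lemma JD_preserves_subspace:
  assumes mod: "lie_module (JD n 0) (scale_jd s) brL sV \<rho>"
    and R: "module.subspace sV R" and r: "r \<in> R"
    and J: "\<And>X. (X, 0) \<in> JD n 0 \<Longrightarrow> \<rho> (X, 0) r \<in> R"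
    and d: "\<And>i. i \<in> {1..n} \<Longrightarrow> \<rho> (d_elt i) r \<in> R"
    and X: "X \<in> JD n 0"
  shows "\<rho> X r \<in> R"
proof -
  interpret vector_space sV using mod by (simp add: lie_module_def)
  have add: "\<rho> (x + y) v = \<rho> x v + \<rho> y v" if "x \<in> JD n 0" "y \<in> JD n 0" for x y v
    using mod that by (auto simp: lie_module_def)
  have D: "\<rho> (0, c) r \<in> R" if "Poly_Mapping.keys c \<subseteq> {1..n}" for c
    using that
  \<comment> \<open>Induction on the support of \<open>c\<close>, splitting off one term c_i d_i at
    a time.\<close>
  proof (induction "Poly_Mapping.keys c" arbitrary: c rule: infinite_finite_induct)
    case infinite
    then show ?case by simp
  next
    case empty
    then have "c = 0" by (metis keys_eq_empty)
    then have "(0, c) = (0 :: 'a jd)" by (simp add: zero_prod_def)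
    then show ?case using lie_module_zero[OF mod] subspace_0[OF R] by (simp add: JD_def)
  next
    case (insert i I)
    let ?a = "Poly_Mapping.lookup c i"
    let ?c = "c - Poly_Mapping.single i ?a"
    have k: "Poly_Mapping.keys ?c = I"
      using insert.hyps(2,4)
      by (auto simp: set_eq_iff in_keys_iff lookup_minus lookup_single when_def split: if_splits)
    have i: "i \<in> {1..n}" "I \<subseteq> {1..n}" using insert.hyps(4) insert.prems by auto
    have "(0, c) = (0, ?c) + scale_jd s ?a (d_elt i :: 'a jd)"
      by (simp add: scale_jd_d_elt)
    moreover have di: "(d_elt i :: 'a jd) \<in> JD n 0"
      and "(0 :: 'a jalg, ?c) \<in> JD n 0" "scale_jd s ?a (d_elt i) \<in> JD n 0"
      using i k by (auto simp: JD_def scale_jd_d_elt) (auto simp: d_elt_def)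
    ultimately have "\<rho> (0, c) r = \<rho> (0, ?c) r + \<rho> (scale_jd s ?a (d_elt i)) r"
      by (metis add)
    also have "\<rho> (scale_jd s ?a (d_elt i)) r = sV ?a (\<rho> (d_elt i) r)"
      using mod di by (simp add: lie_module_def)
    finally have "\<rho> (0, c) r = \<rho> (0, ?c) r + sV ?a (\<rho> (d_elt i) r)" .
    moreover have "\<rho> (0, ?c) r \<in> R" by (rule insert.hyps(3)) (use k i in auto)
    ultimately show ?case using d[OF i(1)] R by (simp add: subspace_add subspace_scale)
  qed
  obtain Y c where Xc: "X = (Y, c)" by (cases X)
  have "\<rho> ((Y, 0) + (0, c)) r = \<rho> (Y, 0) r + \<rho> (0, c) r"
    by (rule add) (use X in \<open>auto simp: JD_def Xc\<close>)
  then show ?thesis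
    using X J D subspace_add[OF R] by (auto simp: JD_def Xc)
qed

text \<open>The range of \<open>Y\<close> is stable under J, which commutes with \<open>Y\<close>,
  and under d_i, since homogeneity gives d_i Y v = Y (d_i v + m_i v). Irreducibility under J + D
  makes it all of V.\<close>

lemma homogeneous_center_J_surj:
  assumes lie: "lie_algebra s br"
    and irr: "irreducible_module (JD n 0) (scale_jd s) (br_jd n s br form) sV \<rho>"
    and Y: "Y \<in> center_J n" and deg: "has_degree n sV \<rho> (\<rho> Y) m"
    and nz: "\<rho> Y \<noteq> (\<lambda>v. 0)"
  shows "surj (\<rho> Y)"
proof -
  have mod: "lie_module (JD n 0) (scale_jd s) (br_jd n s br form) sV \<rho>"
    using irr by (simp add: irreducible_module_def)
  have "Y \<in> JD n 0" using Y center_J_subset_JD by blast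
  then have lin: "Vector_Spaces.linear sV sV (\<rho> Y)" using mod by (simp add: lie_module_def)
  interpret T: Vector_Spaces.linear sV sV "\<rho> Y" by (rule lin)
  have "\<rho> X (\<rho> Y v) \<in> range (\<rho> Y)" if "X \<in> JD n 0" for X v
  proof (rule JD_preserves_subspace[OF mod _ _ _ _ that])
    show "T.vs1.subspace (range (\<rho> Y))" using T.subspace_image[OF T.vs1.subspace_UNIV] .
    show "\<rho> (A, 0) (\<rho> Y v) \<in> range (\<rho> Y)" if "(A, 0) \<in> JD n 0" for A
    proof -
      \<comment> \<open>With D-part zero, membership does not depend on the second index of
        \<open>JD\<close>.\<close>
      have "(A, 0) \<in> JD n (n - 1)" using that by (simp add: JD_def)
      then show ?thesis using center_J_commutes[OF lie mod Y] by (metis le0 rangeI)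
    qed
    show "\<rho> (d_elt i) (\<rho> Y v) \<in> range (\<rho> Y)" if "i \<in> {1..n}" for i
    proof -
      have "\<rho> (d_elt i) (\<rho> Y v) - \<rho> Y (\<rho> (d_elt i) v)
          = sV (of_int (Poly_Mapping.lookup m i)) (\<rho> Y v)"
        using deg that by (simp add: has_degree_def)
      then have "\<rho> (d_elt i) (\<rho> Y v)
          = \<rho> Y (\<rho> (d_elt i) v + sV (of_int (Poly_Mapping.lookup m i)) v)"
        by (simp add: T.add T.scale algebra_simps)
      then show ?thesis by simp
    qed
  qed simp
  with surj_of_range_submodule[OF irr lin nz] show ?thesis .
qed

theorem mainTheorem7:
  fixes n :: nat
    and sg :: "complex \<Rightarrow> 'g::ab_group_add \<Rightarrow> 'g"
    and br :: "'g \<Rightarrow> 'g \<Rightarrow> 'g"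
    and form :: "'g \<Rightarrow> 'g \<Rightarrow> complex"
    and H :: "'g set"
    and sV :: "complex \<Rightarrow> 'v::ab_group_add \<Rightarrow> 'v"
    and \<rho> :: "'g jd \<Rightarrow> 'v \<Rightarrow> 'v"
    and zop :: "nat \<Rightarrow> 'v \<Rightarrow> 'v"
    and k :: "nat \<Rightarrow> nat"
    and W :: "'v set"
    and sV1 :: "complex \<Rightarrow> 'w::ab_group_add \<Rightarrow> 'w"
    and \<rho>1 :: "'g jd \<Rightarrow> 'w \<Rightarrow> 'w"
    and \<pi> :: "'v \<Rightarrow> 'w"
  assumes n: "n \<ge> 2"
    and g: "fd_simple_lie_algebra sg br"
    and form: "nondeg_invariant_form sg br form"
    and H: "cartan_subalgebra sg br H"
    and V_irr: "irreducible_module (JD n 0) (scale_jd sg) (br_jd n sg br form) sV \<rho>"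
    and V_fd: "fd_weight_spaces (cartan_k n H 0) sV \<rho>"
    and zop: "\<And>i. i \<in> {1..n-1} \<Longrightarrow>
        central_operator n sV \<rho> (zop i) \<and> zop i \<noteq> (\<lambda>v. 0) \<and> k i > 0 \<and>
        has_degree n sV \<rho> (zop i) (Poly_Mapping.single i (int (k i)))"
    and W: "maximal_submodule (JD n (n - 1)) sV \<rho> W"
    and V1: "quotient_module (JD n (n - 1)) sV \<rho> W sV1 \<rho>1 \<pi>"
    and V1_irr: "irreducible_module (JD n (n - 1)) (scale_jd sg) (br_jd n sg br form) sV1 \<rho>1"
    and V1_fd: "fd_weight_spaces (cartan_k n H (n - 1)) sV1 \<rho>1"
  shows "(\<forall>z\<in>Z_space n. \<exists>c. \<forall>v. \<rho>1 (Z_to_jd n z) v = sV1 c v) \<and>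
         (\<forall>z\<in>Z_space n. \<forall>m\<in>lattice n.
            has_degree n sV \<rho> (\<rho> (Z_to_jd n z)) m \<and> \<rho> (Z_to_jd n z) \<noteq> (\<lambda>v. 0) \<longrightarrow>
            (\<exists>c. c \<noteq> 0 \<and> (\<forall>v. \<rho>1 (Z_to_jd n z) v = sV1 c v)))"
proof -
  have lie: "lie_algebra sg br" using g by (simp add: fd_simple_lie_algebra_def)
  have mod1: "lie_module (JD n (n - 1)) (scale_jd sg) (br_jd n sg br form) sV1 \<rho>1"
    using V1_irr by (simp add: irreducible_module_def)
  interpret V1: vector_space sV1 using mod1 by (simp add: lie_module_def)
  have scalar: "\<exists>c. \<forall>v. \<rho>1 (Z_to_jd n z) v = sV1 c v" if "z \<in> Z_space n" for z
  proof (rule schur_scalar[OF V1_irr V1_fd cartan_k_subset_JD])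
    note Z = Z_to_jd_in_center_J[OF that]
    show "Vector_Spaces.linear sV1 sV1 (\<rho>1 (Z_to_jd n z))"
      using mod1 center_J_subset_JD Z unfolding lie_module_def by blast
    show "\<rho>1 (Z_to_jd n z) (\<rho>1 x v) = \<rho>1 x (\<rho>1 (Z_to_jd n z) v)" if "x \<in> JD n (n - 1)" for x v
      using center_J_commutes[OF lie mod1 Z that] by simp
  qed
  have "c \<noteq> 0"
    if z: "z \<in> Z_space n" and deg: "has_degree n sV \<rho> (\<rho> (Z_to_jd n z)) m"
      and nz: "\<rho> (Z_to_jd n z) \<noteq> (\<lambda>v. 0)"
      and c: "\<And>v. \<rho>1 (Z_to_jd n z) v = sV1 c v" for z m c
  proof
    assume "c = 0"
    note Z = Z_to_jd_in_center_J[OF z]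
    have surj: "surj (\<rho> (Z_to_jd n z))"
      by (rule homogeneous_center_J_surj[OF lie V_irr Z deg nz])
    have "\<pi> (\<rho> (Z_to_jd n z) v) = 0" for v
      using V1 Z center_J_subset_JD c \<open>c = 0\<close> unfolding quotient_module_def by force
    \<comment> \<open>As the projection intertwines the actions, this composite is zero when c = 0.
      It is also onto, which forces V1 = 0.\<close>
    moreover have "surj (\<pi> \<circ> \<rho> (Z_to_jd n z))"
      using V1 surj by (intro comp_surj) (auto simp: quotient_module_def)
    ultimately have "w = 0" for w :: 'w unfolding surj_def comp_apply by metis
    then show False using V1_irr by (auto simp: irreducible_module_def)
  qed
  with scalar show ?thesis by metis
qed

end
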